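(* Let $G$ be a finite simple connected graph with at least three vertices that is not a cycle of length $4k+r$ for any $k$ and any $r\in\{1,2,3\}$. Suppose one of the following conditions holds: (i) $G$ contains no maximal simple path of length $1$, and for every maximal simple path of $G$ of length congruent to $1$ modulo $4$, connecting two vertices $x$ and $y$, we have $\{\deg(x),\deg(y)\}\neq\{3\}$; (ii) $G$ contains no maximal simple path of length congruent to $3$ modulo $4$, and for every edge $e=xy$ which is a maximal simple path of $G$, $\deg(x)\neq\deg(y)$. Then $\mu(G)\leq 2$.
   Context: A $k$-edge-weighting of a graph $G$ is a function $w:E(G)\to\{1,2,\ldots,k\}$. It induces a vertex coloring $c$ by $c(v)=\sum_{e\sim v}w(e)$, where $e\sim v$ means that $e$ is an edge incident to $v$. If $c$ is a proper vertex coloring ($c(u)\neq c(v)$ for every two adjacent vertices $u,v$), then $w$ is called a vertex-coloring $k$-edge-weighting (VC$k$-EW). $\mu(G)$ denotes the minimum $k$ for which $G$ has a VC$k$-EW. A simple path in $G$ is a walk $x_0,x_1,\ldots,x_\ell$ with $\ell\ge 1$ and pairwise distinct edges, whose internal vertices $x_1,\ldots,x_{\ell-1}$ are pairwise distinct, different from $x_0$ and $x_\ell$, and all of degree $2$ in $G$; the end-vertices $x_0,x_\ell$ may coincide. Its length is $\ell$. It is a maximal simple path if its edge set is not properly contained in that of another simple path. Thus the edge set of $G$ is the disjoint union of the edge sets of its maximal simple paths; if $G$ is a connected graph that is not a cycle, the end-vertices of a maximal simple path have degree different from $2$, and if $G$ is a cycle, the whole cycle is a maximal simple path. *)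

theory Defs
  imports Main "HOL-Library.Extended_Nat"
begin

text \<open>Graphs are given by a vertex set \<open>V\<close> and a set \<open>E\<close> of two-element subsets of \<open>V\<close>.\<close>

definition fin_simple_graph :: "'a set \<Rightarrow> 'a set set \<Rightarrow> bool" where
  "fin_simple_graph V E \<longleftrightarrow> finite V \<and> (\<forall>e\<in>E. e \<subseteq> V \<and> card e = 2)"

definition degree :: "'a set set \<Rightarrow> 'a \<Rightarrow> nat" where
  "degree E v = card {e \<in> E. v \<in> e}"

text \<open>A walk is represented by the list of its successive vertices; its length, the number of
  edges traversed, is the length of \<open>walk_edges\<close>.\<close>

fun walk_edges :: "'a list \<Rightarrow> 'a set list" where
  "walk_edges (x # y # zs) = {x, y} # walk_edges (y # zs)"
| "walk_edges [x] = []"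
| "walk_edges [] = []"

definition walk_length :: "'a list \<Rightarrow> nat" where
  "walk_length xs = length (walk_edges xs)"

definition walk :: "'a set \<Rightarrow> 'a set set \<Rightarrow> 'a list \<Rightarrow> bool" where
  "walk V E xs \<longleftrightarrow> xs \<noteq> [] \<and> set xs \<subseteq> V \<and> set (walk_edges xs) \<subseteq> E"

definition connected_graph :: "'a set \<Rightarrow> 'a set set \<Rightarrow> bool" where
  "connected_graph V E \<longleftrightarrow>
     V \<noteq> {} \<and> (\<forall>u\<in>V. \<forall>v\<in>V. \<exists>xs. walk V E xs \<and> hd xs = u \<and> last xs = v)"

definition is_cycle_of_length :: "'a set \<Rightarrow> 'a set set \<Rightarrow> nat \<Rightarrow> bool" where
  "is_cycle_of_length V E n \<longleftrightarrow> n \<ge> 3 \<and>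
     (\<exists>f. bij_betw f {..<n} V \<and> E = {{f i, f (Suc i mod n)} | i. i < n})"

definition internal_vertices :: "'a list \<Rightarrow> 'a list" where
  "internal_vertices xs = butlast (tl xs)"

text \<open>The end-vertices \<open>hd xs\<close> and \<open>last xs\<close> may coincide.\<close>

definition simple_path :: "'a set \<Rightarrow> 'a set set \<Rightarrow> 'a list \<Rightarrow> bool" where
  "simple_path V E xs \<longleftrightarrow>
     walk V E xs \<and> walk_length xs \<ge> 1 \<and> distinct (walk_edges xs) \<and>
     distinct (internal_vertices xs) \<and>
     hd xs \<notin> set (internal_vertices xs) \<and> last xs \<notin> set (internal_vertices xs) \<and>
     (\<forall>v\<in>set (internal_vertices xs). degree E v = 2)"

definition maximal_simple_path :: "'a set \<Rightarrow> 'a set set \<Rightarrow> 'a list \<Rightarrow> bool" where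
  "maximal_simple_path V E xs \<longleftrightarrow>
     simple_path V E xs \<and>
     \<not> (\<exists>ys. simple_path V E ys \<and> set (walk_edges xs) \<subset> set (walk_edges ys))"

text \<open>Only the values of a weighting on \<open>E\<close> matter.\<close>

definition edge_weighting :: "'a set set \<Rightarrow> nat \<Rightarrow> ('a set \<Rightarrow> nat) \<Rightarrow> bool" where
  "edge_weighting E k w \<longleftrightarrow> (\<forall>e\<in>E. w e \<in> {1..k})"

definition induced_coloring :: "'a set set \<Rightarrow> ('a set \<Rightarrow> nat) \<Rightarrow> 'a \<Rightarrow> nat" where
  "induced_coloring E w v = (\<Sum>e | e \<in> E \<and> v \<in> e. w e)"

definition proper_coloring :: "'a set set \<Rightarrow> ('a \<Rightarrow> nat) \<Rightarrow> bool" where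
  "proper_coloring E c \<longleftrightarrow> (\<forall>u v. {u, v} \<in> E \<longrightarrow> c u \<noteq> c v)"

definition vertex_coloring_edge_weighting ::
    "'a set set \<Rightarrow> nat \<Rightarrow> ('a set \<Rightarrow> nat) \<Rightarrow> bool" where
  "vertex_coloring_edge_weighting E k w \<longleftrightarrow>
     edge_weighting E k w \<and> proper_coloring E (induced_coloring E w)"

text \<open>The minimum is taken in \<^typ>\<open>enat\<close>, so that \<open>mu E = \<infinity>\<close> when no suitable \<open>k\<close>
  exists (e.g. when some component of the graph is a single edge).\<close>

definition mu :: "'a set set \<Rightarrow> enat" where
  "mu E = Inf {enat k | k. \<exists>w. vertex_coloring_edge_weighting E k w}"

end

theory Submission imports Defs begin

text \<open>If \<open>uv\<close> is an edge between two vertices of degree 2, the colours of \<open>u\<close> and \<open>v\<close> differ exactly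
  when the edge before and the edge after \<open>uv\<close> have different weights. With the weights 1 and 2, this
  determines a weighting along a maximal simple path from the weights of its first two edges: every
  weight is followed, two edges later, by the other one (\<open>alternating\<close>).

  On a cycle whose length is a multiple of 4, the pattern 1, 1, 2, 2 closes up
  (\<open>cycle_vertex_coloring_edge_weighting\<close>). In a connected graph that is not a cycle the maximal
  simple paths end in vertices whose degree is not 2 (\<open>maximal_simple_path_ends\<close>) and their edge sets partition
  the edges (\<open>maximal_simple_path_edges_eq\<close>, \<open>edge_in_maximal_simple_path\<close>), so the two free
  weights can be chosen for each path separately (\<open>weighting_from_paths\<close>). What remains are the edges
  \<open>e = xv\<close> at an end-vertex \<open>x\<close>.

  Under condition (i), \<open>v\<close> has degree 2. Let \<open>f\<close> be its other edge. The colours of \<open>x\<close> and \<open>v\<close> agree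
  only if the edges at \<open>x\<close> other than \<open>e\<close> have the total weight of \<open>f\<close>, which forces \<open>x\<close> to have
  degree 3 and \<open>f\<close> to have weight 2 (\<open>induced_coloring_end_vertex\<close>). It therefore suffices that the
  second edge of a path, seen from an end of degree 3, has weight 1. This can be achieved at both ends
  at once unless the length is 1 modulo 4, and then it is needed at one end only
  (\<open>weights_for_second_edges\<close>).

  Under condition (ii), all edges at vertices of degree other than 2 get weight 2, which the
  alternation allows since no length is 3 modulo 4 (\<open>weights_for_end_edges\<close>). Such a vertex of degree
  \<open>d\<close> has colour \<open>2 * d\<close>, which is 2 or at least 6, whereas an adjacent vertex of degree 2 has colour 3
  or 4; and the ends of a path of length 1 have different degrees.\<close>

section \<open>Walks by their indices\<close>

lemma length_walk_edges: "length (walk_edges xs) = length xs - 1"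
  by (induct xs rule: walk_edges.induct) auto

lemma nth_walk_edges:
  "Suc i < length xs \<Longrightarrow> walk_edges xs ! i = {xs ! i, xs ! Suc i}"
proof (induct xs arbitrary: i rule: walk_edges.induct)
  case (1 x y zs)
  then show ?case by (cases i) auto
qed auto

lemma in_walk_edges_iff:
  "e \<in> set (walk_edges xs) \<longleftrightarrow> (\<exists>i. Suc i < length xs \<and> e = {xs ! i, xs ! Suc i})"
  unfolding in_set_conv_nth by (metis length_walk_edges less_diff_conv nth_walk_edges Suc_eq_plus1)

lemma walk_edges_rev: "walk_edges (rev xs) = rev (walk_edges xs)"
proof (rule nth_equalityI)
  fix i assume "i < length (walk_edges (rev xs))"
  then have i: "Suc i < length xs" by (simp add: length_walk_edges)
  then have eq: "length xs - Suc i = Suc (length xs - Suc (Suc i))" by simp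
  have "walk_edges (rev xs) ! i = {xs ! (length xs - Suc i), xs ! (length xs - Suc (Suc i))}"
    using i by (simp add: nth_walk_edges rev_nth)
  also have "\<dots> = walk_edges xs ! (length xs - Suc (Suc i))"
    using i by (subst nth_walk_edges) (auto simp: eq)
  also have "\<dots> = rev (walk_edges xs) ! i"
    using i by (simp add: rev_nth length_walk_edges)
  finally show "walk_edges (rev xs) ! i = rev (walk_edges xs) ! i" .
qed (simp add: length_walk_edges)

lemma simple_path_length:
  assumes "simple_path V E xs"
  shows "length xs = Suc (walk_length xs)" "walk_length xs \<ge> 1"
  using assms by (auto simp: simple_path_def walk_length_def length_walk_edges)

lemma simple_path_ends:
  assumes "simple_path V E xs"
  shows "hd xs = xs ! 0" "last xs = xs ! walk_length xs"
  using simple_path_length[OF assms]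
  by (auto simp: hd_conv_nth last_conv_nth simp flip: length_0_conv)

lemma simple_path_edge:
  assumes "simple_path V E xs" "i < walk_length xs"
  shows "walk_edges xs ! i = {xs ! i, xs ! Suc i}" "{xs ! i, xs ! Suc i} \<in> E"
proof -
  have i: "Suc i < length xs" using assms simple_path_length by fastforce
  then show "walk_edges xs ! i = {xs ! i, xs ! Suc i}" by (rule nth_walk_edges)
  show "{xs ! i, xs ! Suc i} \<in> E"
    using assms(1) i in_walk_edges_iff[of _ xs] by (auto simp: simple_path_def walk_def)
qed

lemma nth_internal_vertices:
  "Suc (Suc k) < length xs \<Longrightarrow> internal_vertices xs ! k = xs ! Suc k"
  by (simp add: internal_vertices_def nth_butlast nth_tl)

lemma simple_path_degree:
  assumes "simple_path V E xs" "0 < i" "i < walk_length xs"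
  shows "degree E (xs ! i) = 2"
proof -
  obtain k where k: "i = Suc k" using assms(2) by (cases i) auto
  then have "xs ! i = internal_vertices xs ! k" "k < length (internal_vertices xs)"
    using assms simple_path_length[OF assms(1)]
    by (simp_all add: nth_internal_vertices) (simp add: internal_vertices_def)
  then show ?thesis using assms(1) by (auto simp: simple_path_def)
qed

lemma simple_path_distinct:
  assumes "simple_path V E xs" "0 < i" "i < walk_length xs" "j \<le> walk_length xs" "i \<noteq> j"
  shows "xs ! i \<noteq> xs ! j"
proof -
  note L = simple_path_length[OF assms(1)]
  have int: "xs ! m = internal_vertices xs ! (m - 1) \<and> m - 1 < length (internal_vertices xs)"
    if "0 < m" "m < walk_length xs" for m
    using that L by (cases m) (auto simp: nth_internal_vertices, simp add: internal_vertices_def)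
  have ends: "xs ! 0 \<notin> set (internal_vertices xs)"
      "xs ! walk_length xs \<notin> set (internal_vertices xs)"
    using assms(1) simple_path_ends[OF assms(1)] by (simp_all add: simple_path_def)
  have dist: "distinct (internal_vertices xs)" using assms(1) by (simp add: simple_path_def)
  consider "j = 0" | "j = walk_length xs" | "0 < j" "j < walk_length xs" using assms(4) by linarith
  then show ?thesis
  proof cases
    case 3
    have "i - 1 \<noteq> j - 1" using assms(2,5) 3 by linarith
    then show ?thesis using int[OF assms(2,3)] int[OF 3] dist nth_eq_iff_index_eq by metis
  qed (use ends int[OF assms(2,3)] nth_mem in metis)+
qed

lemma simple_path_rev:
  assumes "simple_path V E xs"
  shows "simple_path V E (rev xs)"
proof -
  have "internal_vertices (rev xs) = rev (internal_vertices xs)"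
    unfolding internal_vertices_def by (metis butlast_rev butlast_tl rev_rev_ident)
  then show ?thesis
    using assms by (auto simp: simple_path_def walk_def walk_length_def walk_edges_rev hd_rev last_rev)
qed

lemma maximal_simple_path_rev:
  "maximal_simple_path V E xs \<Longrightarrow> maximal_simple_path V E (rev xs)"
  by (simp add: maximal_simple_path_def simple_path_rev walk_edges_rev)

context
  fixes V :: "'a set" and E :: "'a set set"
  assumes G: "fin_simple_graph V E"
begin

section \<open>Maximal simple paths\<close>

lemma finite_edges: "finite E"
proof (rule finite_subset)
  show "E \<subseteq> Pow V" "finite (Pow V)" using G by (auto simp: fin_simple_graph_def)
qed

lemma edge_ends:
  assumes "{u, v} \<in> E"
  shows "u \<noteq> v" "u \<in> V" "v \<in> V"
  using assms G by (auto simp: fin_simple_graph_def)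

lemma edgeE:
  assumes "e \<in> E"
  obtains u v where "e = {u, v}" "u \<noteq> v" "u \<in> V" "v \<in> V"
  using assms G by (auto simp: fin_simple_graph_def card_2_iff)

lemma edges_at_degree_two:
  assumes "degree E v = 2" "e \<in> E" "f \<in> E" "v \<in> e" "v \<in> f" "e \<noteq> f"
  shows "{g \<in> E. v \<in> g} = {e, f}"
proof (rule card_subset_eq[symmetric])
  show "finite {g \<in> E. v \<in> g}" using finite_edges by simp
  show "card {e, f} = card {g \<in> E. v \<in> g}" using assms by (simp add: degree_def)
qed (use assms in auto)

lemma edges_at_internal_vertex:
  assumes xs: "simple_path V E xs" and i: "Suc i < walk_length xs"
  shows "{g \<in> E. xs ! Suc i \<in> g} = {walk_edges xs ! i, walk_edges xs ! Suc i}"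
    and "walk_edges xs ! i \<noteq> walk_edges xs ! Suc i"
proof -
  show neq: "walk_edges xs ! i \<noteq> walk_edges xs ! Suc i"
    using xs i by (auto simp: simple_path_def walk_length_def nth_eq_iff_index_eq)
  show "{g \<in> E. xs ! Suc i \<in> g} = {walk_edges xs ! i, walk_edges xs ! Suc i}"
  proof (rule edges_at_degree_two)
    show "degree E (xs ! Suc i) = 2" using simple_path_degree[OF xs _ i] by simp
  qed (use neq simple_path_edge[OF xs, of i] simple_path_edge[OF xs, of "Suc i"] i in auto)
qed

text \<open>A vertex of degree 2 on the path is not one of its ends, hence internal.\<close>

lemma edges_at_path_vertex:
  assumes xs: "simple_path V E xs" and ends: "degree E (hd xs) \<noteq> 2" "degree E (last xs) \<noteq> 2"
    and e: "e \<in> set (walk_edges xs)" and v: "v \<in> e" "degree E v = 2"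
  shows "{g \<in> E. v \<in> g} \<subseteq> set (walk_edges xs)"
proof -
  note L = simple_path_length[OF xs]
  obtain i where "i < walk_length xs" "v = xs ! i \<or> v = xs ! Suc i"
    using e v(1) L by (auto simp: in_walk_edges_iff)
  then obtain j where j: "j \<le> walk_length xs" "v = xs ! j" using less_imp_le Suc_leI by metis
  then have "j \<noteq> 0" "j \<noteq> walk_length xs"
    using ends v(2) simple_path_ends[OF xs] by metis+
  with j obtain i where i: "v = xs ! Suc i" "Suc i < walk_length xs" by (cases j) auto
  show ?thesis
    unfolding i(1) edges_at_internal_vertex[OF xs i(2)] using i(2) by (auto simp: walk_length_def)
qed

text \<open>Consecutive edges of a simple path share a vertex of degree 2, so a set of edges that is
  closed under passing through such vertices cannot be left along a simple path.\<close>

lemma simple_path_in_closed_set: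
  assumes ys: "simple_path V E ys" and meet: "e \<in> set (walk_edges ys)" "e \<in> F"
    and closed: "\<And>f v. f \<in> F \<Longrightarrow> v \<in> f \<Longrightarrow> degree E v = 2 \<Longrightarrow> {g \<in> E. v \<in> g} \<subseteq> F"
  shows "set (walk_edges ys) \<subseteq> F"
proof -
  have step: "walk_edges ys ! i \<in> F \<longleftrightarrow> walk_edges ys ! Suc i \<in> F"
    if i: "Suc i < walk_length ys" for i
  proof -
    have *: "{g \<in> E. ys ! Suc i \<in> g} = {walk_edges ys ! i, walk_edges ys ! Suc i}"
      by (rule edges_at_internal_vertex[OF ys i])
    have "degree E (ys ! Suc i) = 2" using simple_path_degree[OF ys _ i] by simp
    then show ?thesis using closed * by blast
  qed
  have all: "walk_edges ys ! i \<in> F \<longleftrightarrow> walk_edges ys ! 0 \<in> F" if "i < walk_length ys" for i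
    using that by (induct i) (auto simp: step)
  then show ?thesis using meet by (metis in_set_conv_nth subsetI walk_length_def)
qed

text \<open>By the two preceding lemmas each of two such paths contains the other as soon as they meet in an
  edge.\<close>

lemma maximal_simple_path_edges_eq:
  assumes ends: "\<And>xs. maximal_simple_path V E xs \<Longrightarrow> degree E (hd xs) \<noteq> 2 \<and> degree E (last xs) \<noteq> 2"
    and "maximal_simple_path V E xs" "maximal_simple_path V E ys"
    and "e \<in> set (walk_edges xs)" "e \<in> set (walk_edges ys)"
  shows "set (walk_edges xs) = set (walk_edges ys)"
proof -
  have "set (walk_edges zs) \<subseteq> set (walk_edges us)"
    if "maximal_simple_path V E zs" "maximal_simple_path V E us"
      "e \<in> set (walk_edges zs)" "e \<in> set (walk_edges us)" for zs us
    using that ends[OF that(2)]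
    by (intro simple_path_in_closed_set[of zs e] edges_at_path_vertex)
       (auto simp: maximal_simple_path_def)
  then show ?thesis using assms(2-) by blast
qed

lemma edge_in_maximal_simple_path:
  assumes e: "e \<in> E"
  obtains xs where "maximal_simple_path V E xs" "e \<in> set (walk_edges xs)"
proof -
  obtain u v where uv: "e = {u, v}" "u \<noteq> v" "u \<in> V" "v \<in> V" using e by (rule edgeE)
  let ?P = "\<lambda>xs. simple_path V E xs \<and> e \<in> set (walk_edges xs)"
  have single: "?P [u, v]"
    using uv e by (auto simp: simple_path_def walk_def walk_length_def internal_vertices_def)
  have "set (walk_edges xs) \<subseteq> E" if "?P xs" for xs
    using that unfolding simple_path_def walk_def by blast
  then have bound: "\<forall>xs. ?P xs \<longrightarrow> card (set (walk_edges xs)) < Suc (card E)"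
    by (simp add: card_mono[OF finite_edges] less_Suc_eq_le)
  from ex_has_greatest_nat[of ?P _ "\<lambda>xs. card (set (walk_edges xs))", OF single bound]
  obtain xs where xs: "?P xs"
      and max: "\<And>ys. ?P ys \<Longrightarrow> card (set (walk_edges ys)) \<le> card (set (walk_edges xs))"
    by blast
  have "maximal_simple_path V E xs"
    unfolding maximal_simple_path_def
  proof (intro conjI notI)
    assume "\<exists>ys. simple_path V E ys \<and> set (walk_edges xs) \<subset> set (walk_edges ys)"
    then obtain ys where ys: "simple_path V E ys" "set (walk_edges xs) \<subset> set (walk_edges ys)" by blast
    then have "card (set (walk_edges xs)) < card (set (walk_edges ys))"
      by (intro psubset_card_mono) auto
    then show False using max[of ys] xs ys by auto
  qed (use xs in simp)
  then show ?thesis using that xs by blast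
qed

lemma walk_in_closed_set:
  assumes "walk V E ys" "hd ys \<in> S" and closed: "\<And>u v. u \<in> S \<Longrightarrow> {u, v} \<in> E \<Longrightarrow> v \<in> S"
  shows "set ys \<subseteq> S"
  using assms(1,2)
proof (induct ys rule: walk_edges.induct)
  case (1 x y zs)
  then have "y \<in> S" using closed by (auto simp: walk_def)
  then show ?case using 1 by (auto simp: walk_def)
qed (auto simp: walk_def)

text \<open>A simple path that returns to its start, itself of degree 2, contains every edge at each of
  its vertices, so by connectedness nothing else is left in the graph.\<close>

lemma closed_simple_path_is_cycle:
  assumes conn: "connected_graph V E" and xs: "simple_path V E xs"
    and "hd xs = last xs" and deg: "degree E (hd xs) = 2"
  shows "is_cycle_of_length V E (walk_length xs)"
proof -
  define n where "n = walk_length xs"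
  have len: "length xs = Suc n" "n \<ge> 1" using simple_path_length[OF xs] by (auto simp: n_def)
  have wrap: "xs ! n = xs ! 0" using assms(3) simple_path_ends[OF xs] by (simp add: n_def)
  note edge = simple_path_edge[OF xs, folded n_def]
  have neq: "walk_edges xs ! i \<noteq> walk_edges xs ! j" if "i < n" "j < n" "i \<noteq> j" for i j
    using xs that by (simp add: simple_path_def n_def walk_length_def nth_eq_iff_index_eq)
  have mem: "walk_edges xs ! i \<in> set (walk_edges xs)" if "i < n" for i
    using that by (simp add: n_def walk_length_def)
  have "n \<noteq> 1" using edge(2)[of 0] wrap edge_ends(1)[of "xs ! 0" "xs ! 1"] by auto
  moreover have "n \<noteq> 2"
    using edge(1)[of 0] edge(1)[of 1] wrap neq[of 0 1] by (auto simp: insert_commute numeral_2_eq_2)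
  ultimately have n3: "n \<ge> 3" using len(2) by linarith
  have at_vertex: "{g \<in> E. xs ! i \<in> g} \<subseteq> set (walk_edges xs)" if "i < n" for i
  proof (cases i)
    case 0
    have first: "walk_edges xs ! 0 \<in> E" "xs ! 0 \<in> walk_edges xs ! 0"
      using edge[of 0] n3 by simp_all
    have n: "n - 1 < n" "Suc (n - 1) = n" using n3 by simp_all
    have last: "walk_edges xs ! (n - 1) \<in> E" "xs ! 0 \<in> walk_edges xs ! (n - 1)"
      using edge[OF n(1)] unfolding n(2) wrap by simp_all
    have "{g \<in> E. xs ! 0 \<in> g} = {walk_edges xs ! 0, walk_edges xs ! (n - 1)}"
    proof (rule edges_at_degree_two)
      show "degree E (xs ! 0) = 2" using deg simple_path_ends[OF xs] by simp
      show "walk_edges xs ! 0 \<noteq> walk_edges xs ! (n - 1)" using neq n3 by simp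
    qed (fact first last)+
    then show ?thesis using 0 mem[of 0] mem[OF n(1)] n3 by simp
  next
    case (Suc k)
    then show ?thesis
      using edges_at_internal_vertex(1)[OF xs, of k, folded n_def] that mem[of k] mem[of "Suc k"]
      by simp
  qed
  have set_xs: "set xs = (!) xs ` {..<n}"
  proof -
    have "set xs = (!) xs ` {..<Suc n}" using len(1) by (auto simp: set_conv_nth)
    also have "\<dots> = insert (xs ! 0) ((!) xs ` {..<n})" using wrap by (simp add: lessThan_Suc)
    also have "\<dots> = (!) xs ` {..<n}" using n3 by (intro insert_absorb imageI) simp
    finally show ?thesis .
  qed
  have closed: "v \<in> set xs" if "u \<in> set xs" "{u, v} \<in> E" for u v
  proof -
    have "{u, v} \<in> set (walk_edges xs)" using that at_vertex set_xs by auto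
    then show ?thesis by (auto simp: in_walk_edges_iff doubleton_eq_iff)
  qed
  have V: "set xs = V"
  proof
    show "set xs \<subseteq> V" using xs by (simp add: simple_path_def walk_def)
    show "V \<subseteq> set xs"
    proof
      fix v assume v: "v \<in> V"
      have h: "hd xs \<in> set xs" using len(1) by (intro hd_in_set) auto
      then obtain ys where ys: "walk V E ys" "hd ys = hd xs" "last ys = v"
        using conn v \<open>set xs \<subseteq> V\<close> unfolding connected_graph_def by blast
      have "set ys \<subseteq> set xs"
        by (rule walk_in_closed_set[OF ys(1)]) (use ys h closed in auto)
      then show "v \<in> set xs" using ys by (auto simp: walk_def)
    qed
  qed
  have "inj_on ((!) xs) {..<n}"
  proof (rule linorder_inj_onI)
    fix i j assume "i < j" "i \<in> {..<n}" "j \<in> {..<n}"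
    then show "xs ! i \<noteq> xs ! j" using simple_path_distinct[OF xs, of j i] by (auto simp: n_def)
  qed auto
  then have bij: "bij_betw ((!) xs) {..<n} V" using set_xs V by (simp add: bij_betw_def)
  have suc: "xs ! (Suc i mod n) = xs ! Suc i" if "i < n" for i
    using that wrap by (auto simp: mod_Suc)
  have E: "E = {{xs ! i, xs ! (Suc i mod n)} | i. i < n}" (is "_ = ?R")
  proof
    show "?R \<subseteq> E" using edge(2) suc by auto
    show "E \<subseteq> ?R"
    proof
      fix e assume e: "e \<in> E"
      then obtain u where "u \<in> e" "u \<in> V" by (rule edgeE) auto
      then have "e \<in> set (walk_edges xs)" using at_vertex e V set_xs by auto
      then show "e \<in> ?R" using suc len(1) by (auto simp: in_walk_edges_iff)
    qed
  qed
  show ?thesis unfolding is_cycle_of_length_def n_def[symmetric] using n3 bij E by blast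
qed

text \<open>At a start of degree 2 there is a second edge. If the path uses it, it uses it last and is
  closed; otherwise the path can be prolonged by it.\<close>

lemma maximal_simple_path_hd:
  assumes conn: "connected_graph V E" and no_cycle: "\<nexists>n. is_cycle_of_length V E n"
    and max: "maximal_simple_path V E xs"
  shows "degree E (hd xs) \<noteq> 2"
proof
  assume deg: "degree E (hd xs) = 2"
  have xs: "simple_path V E xs" using max by (simp add: maximal_simple_path_def)
  note L = simple_path_length[OF xs]
  have open_path: "hd xs \<noteq> last xs"
    using closed_simple_path_is_cycle[OF conn xs _ deg] no_cycle by blast
  obtain x y zs where xyz: "xs = x # y # zs"
    using L by (metis One_nat_def Suc_le_length_iff Suc_le_mono)
  have "\<not> {g \<in> E. x \<in> g} \<subseteq> {{x, y}}"
    using deg card_mono[of "{{x, y}}" "{g \<in> E. x \<in> g}"] xyz by (auto simp: degree_def)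
  then obtain f where f: "f \<in> E" "x \<in> f" "f \<noteq> {x, y}" by auto
  then obtain z where z: "f = {z, x}" "z \<noteq> x" "z \<in> V"
    using edgeE[of f] by (metis insertE insert_commute singletonD)
  have new: "f \<notin> set (walk_edges xs)"
  proof
    assume "f \<in> set (walk_edges xs)"
    then obtain i where i: "i < walk_length xs" "f = {xs ! i, xs ! Suc i}"
      using L by (auto simp: in_walk_edges_iff)
    have "i \<noteq> 0" using f(3) i(2) xyz by auto
    then have "xs ! i \<noteq> xs ! 0" using simple_path_distinct[OF xs, of i 0] i by simp
    moreover have "xs ! Suc i \<noteq> xs ! 0"
    proof (cases "Suc i = walk_length xs")
      case True
      then show ?thesis using open_path simple_path_ends[OF xs] by simp
    next
      case False
      then show ?thesis using simple_path_distinct[OF xs, of "Suc i" 0] i by simp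
    qed
    ultimately show False using f(2) i(2) xyz by auto
  qed
  have z_not_internal: "z \<notin> set (internal_vertices xs)"
  proof
    assume "z \<in> set (internal_vertices xs)"
    then obtain k where "k < length (internal_vertices xs)" "z = internal_vertices xs ! k"
      by (auto simp: in_set_conv_nth)
    then have k: "Suc k < walk_length xs" "z = xs ! Suc k"
      using L by (auto simp: nth_internal_vertices internal_vertices_def nth_butlast nth_tl)
    have "f \<in> {g \<in> E. xs ! Suc k \<in> g}" using f(1) z(1) k(2) by blast
    then have "f \<in> {walk_edges xs ! k, walk_edges xs ! Suc k}"
      unfolding edges_at_internal_vertex(1)[OF xs k(1)] .
    then show False using new k(1) by (auto simp: walk_length_def)
  qed
  have "simple_path V E (z # xs)"
    using xs f(1) z new z_not_internal open_path deg xyz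
    unfolding simple_path_def walk_def walk_length_def internal_vertices_def
    by (auto split: if_splits)
  moreover have "walk_edges (z # xs) = f # walk_edges xs" using z(1) xyz by simp
  then have "set (walk_edges xs) \<subset> set (walk_edges (z # xs))" using new by auto
  ultimately show False using max unfolding maximal_simple_path_def by blast
qed

lemma maximal_simple_path_ends:
  assumes "connected_graph V E" "\<nexists>n. is_cycle_of_length V E n" "maximal_simple_path V E xs"
  shows "degree E (hd xs) \<noteq> 2 \<and> degree E (last xs) \<noteq> 2"
  using maximal_simple_path_hd[OF assms(1,2) assms(3)]
    maximal_simple_path_hd[OF assms(1,2) maximal_simple_path_rev[OF assms(3)]]
  by (simp add: hd_rev)

section \<open>Weightings built path by path\<close>

text \<open>A maximal path and its reverse are different lists with the same edges, and \<open>\<phi>\<close> depends on the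
  list. So one list is fixed for each edge set, and the weights are read off that list.\<close>

lemma weighting_from_paths:
  assumes ends: "\<And>xs. maximal_simple_path V E xs \<Longrightarrow> degree E (hd xs) \<noteq> 2 \<and> degree E (last xs) \<noteq> 2"
    and ex: "\<And>xs. maximal_simple_path V E xs \<Longrightarrow> \<exists>\<phi>. P xs \<phi>"
  shows "\<exists>w :: 'a set \<Rightarrow> nat. \<forall>e\<in>E. \<exists>xs. maximal_simple_path V E xs \<and> e \<in> set (walk_edges xs) \<and>
           (\<exists>\<phi>. P xs \<phi> \<and> (\<forall>j<walk_length xs. w (walk_edges xs ! j) = \<phi> j))"
proof -
  let ?M = "maximal_simple_path V E"
  define cls where "cls e = set (walk_edges (SOME xs. ?M xs \<and> e \<in> set (walk_edges xs)))" for e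
  define p where "p e = (SOME xs. ?M xs \<and> set (walk_edges xs) = cls e)" for e
  define \<phi> where "\<phi> xs = (SOME f. P xs f)" for xs
  define w where
    "w e = \<phi> (p e) (SOME j. j < walk_length (p e) \<and> walk_edges (p e) ! j = e)" for e
  have some: "?M (SOME xs. ?M xs \<and> e \<in> set (walk_edges xs)) \<and> e \<in> cls e" if "e \<in> E" for e
    unfolding cls_def using edge_in_maximal_simple_path[OF that] by (metis (mono_tags, lifting) someI_ex)
  have p: "?M (p e) \<and> set (walk_edges (p e)) = cls e" if "e \<in> E" for e
    unfolding p_def by (rule someI_ex) (use some[OF that] cls_def in blast)
  have same: "p f = p e" if "e \<in> E" "f \<in> cls e" for e f
  proof -
    have "f \<in> E" using that p[OF that(1)]
      by (auto simp: maximal_simple_path_def simple_path_def walk_def)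
    then have "cls f = cls e"
      using maximal_simple_path_edges_eq[OF ends, of "p f" "p e" f] p[of f] p[of e] some[of f] that
      by auto
    then show ?thesis by (simp add: p_def)
  qed
  show ?thesis
  proof (intro exI[of _ w] ballI)
    fix e assume e: "e \<in> E"
    have "w (walk_edges (p e) ! j) = \<phi> (p e) j" if j: "j < walk_length (p e)" for j
    proof -
      have "p (walk_edges (p e) ! j) = p e"
        using same[OF e] p[OF e] j by (metis nth_mem walk_length_def)
      moreover have "(SOME i. i < walk_length (p e) \<and> walk_edges (p e) ! i = walk_edges (p e) ! j) = j"
        using j p[OF e]
        by (intro some_equality)
           (auto simp: maximal_simple_path_def simple_path_def walk_length_def nth_eq_iff_index_eq)
      ultimately show ?thesis by (simp add: w_def)
    qed
    moreover have "P (p e) (\<phi> (p e))"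
      unfolding \<phi>_def using ex p[OF e] by (intro someI_ex[of "P (p e)"]) blast
    ultimately show "\<exists>xs. ?M xs \<and> e \<in> set (walk_edges xs) \<and>
           (\<exists>\<phi>. P xs \<phi> \<and> (\<forall>j<walk_length xs. w (walk_edges xs ! j) = \<phi> j))"
      using p[OF e] some[OF e] by blast
  qed
qed

lemma induced_coloring_internal_vertex:
  assumes "simple_path V E xs" "Suc i < walk_length xs"
  shows "induced_coloring E w (xs ! Suc i) = w (walk_edges xs ! i) + w (walk_edges xs ! Suc i)"
  unfolding induced_coloring_def
  using edges_at_internal_vertex[OF assms] by simp

text \<open>Two neighbouring internal vertices share the middle one of three consecutive edges, so their
  colours differ as soon as the two outer edges have different weights; only the first and the last
  edge of a path then still need attention.\<close>

lemma proper_coloring_from_paths: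
  assumes "\<And>e. e \<in> E \<Longrightarrow> \<exists>xs. simple_path V E xs \<and> e \<in> set (walk_edges xs) \<and>
      (\<forall>i. Suc (Suc i) < walk_length xs \<longrightarrow> w (walk_edges xs ! i) \<noteq> w (walk_edges xs ! Suc (Suc i))) \<and>
      induced_coloring E w (xs ! 0) \<noteq> induced_coloring E w (xs ! 1) \<and>
      induced_coloring E w (xs ! (walk_length xs - 1)) \<noteq> induced_coloring E w (xs ! walk_length xs)"
  shows "proper_coloring E (induced_coloring E w)"
  unfolding proper_coloring_def
proof (intro allI impI)
  fix u v assume "{u, v} \<in> E"
  from assms[OF this] obtain xs where xs: "simple_path V E xs" "{u, v} \<in> set (walk_edges xs)"
    and alt: "\<And>i. Suc (Suc i) < walk_length xs \<Longrightarrow> w (walk_edges xs ! i) \<noteq> w (walk_edges xs ! Suc (Suc i))"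
    and ends: "induced_coloring E w (xs ! 0) \<noteq> induced_coloring E w (xs ! 1)"
      "induced_coloring E w (xs ! (walk_length xs - 1)) \<noteq> induced_coloring E w (xs ! walk_length xs)"
    by blast
  obtain i where i: "i < walk_length xs" "{u, v} = {xs ! i, xs ! Suc i}"
    using xs simple_path_length[OF xs(1)] by (auto simp: in_walk_edges_iff)
  have "induced_coloring E w (xs ! i) \<noteq> induced_coloring E w (xs ! Suc i)"
  proof (cases "i = 0 \<or> Suc i = walk_length xs")
    case True
    then show ?thesis using ends by (metis One_nat_def diff_Suc_1)
  next
    case False
    then obtain k where k: "i = Suc k" "Suc (Suc k) < walk_length xs" using i by (cases i) auto
    then show ?thesis
      using alt[of k] induced_coloring_internal_vertex[OF xs(1), of k w]
        induced_coloring_internal_vertex[OF xs(1), of "Suc k" w] by simp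
  qed
  then show "induced_coloring E w u \<noteq> induced_coloring E w v"
    using i(2) by (auto simp: doubleton_eq_iff)
qed

text \<open>Cancelling the weight of \<open>e\<close>, the colours agree only if the remaining edges at \<open>x\<close> have total
  weight \<open>b \<le> 2\<close>. A vertex of degree 1 has none, and a vertex of degree at least 4 has at least
  three.\<close>

lemma induced_coloring_end_vertex:
  assumes w: "\<And>f. f \<in> E \<Longrightarrow> w f \<ge> 1" and e: "e \<in> E" "x \<in> e" and deg: "degree E x \<noteq> 2"
    and b: "b \<in> {1, 2}" "degree E x = 3 \<Longrightarrow> b = 1"
  shows "induced_coloring E w x \<noteq> w e + b"
proof -
  let ?S = "{f \<in> E. x \<in> f}"
  have fin: "finite ?S" using finite_edges by simp
  have eS: "e \<in> ?S" using e by simp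
  have sum: "induced_coloring E w x = w e + sum w (?S - {e})"
    unfolding induced_coloring_def using sum.remove[OF fin eS] by simp
  have card: "card (?S - {e}) = degree E x - 1" using eS fin by (simp add: degree_def)
  have "sum w (?S - {e}) \<ge> (\<Sum>f\<in>?S - {e}. 1)" by (rule sum_mono) (use w in auto)
  then have ge: "sum w (?S - {e}) \<ge> degree E x - 1" using card by simp
  have "sum w (?S - {e}) \<noteq> b"
  proof (cases "degree E x \<le> 1")
    case True
    then have "?S - {e} = {}" using card fin by simp
    then have "sum w (?S - {e}) = 0" by (simp only: sum.empty)
    then show ?thesis using b(1) by auto
  next
    case False
    then show ?thesis using ge b deg by (cases "degree E x = 3") auto
  qed
  then show ?thesis using sum by simp
qed

end

section \<open>The weights along a path\<close>

text \<open>The general solution, with values in \<open>{1, 2}\<close>, of \<open>\<phi> i + \<phi> (i + 2) = 3\<close>.\<close>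

definition alternating :: "nat \<Rightarrow> nat \<Rightarrow> nat \<Rightarrow> nat" where
  "alternating a b i = (if i mod 4 = 0 then a else if i mod 4 = 1 then b
     else if i mod 4 = 2 then 3 - a else 3 - b)"

lemma alternating_range:
  "a \<in> {1, 2} \<Longrightarrow> b \<in> {1, 2} \<Longrightarrow> alternating a b i \<in> {1, 2}"
  by (auto simp: alternating_def)

lemma alternating_neq:
  assumes "a \<in> {1, 2}" "b \<in> {1, 2}"
  shows "alternating a b i \<noteq> alternating a b (Suc (Suc i))"
proof -
  have "i mod 4 < 4" by simp
  then consider "i mod 4 = 0" | "i mod 4 = 1" | "i mod 4 = 2" | "i mod 4 = 3" by linarith
  then show ?thesis using assms by cases (auto simp: alternating_def mod_Suc)
qed

text \<open>The entries 1 and \<open>l - 2\<close> are the second edges seen from the two ends. They can both be given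
  weight 1 unless \<open>l mod 4 = 1\<close>: then their distance is 2 modulo 4, so one of them has weight 2.
  The propositions \<open>A\<close> and \<open>B\<close> say at which ends the weight 1 is needed.\<close>

lemma weights_for_second_edges:
  fixes l :: nat
  assumes l: "l \<ge> 2" and one: "l mod 4 = 1 \<Longrightarrow> \<not> (A \<and> B)"
  shows "\<exists>a\<in>{1, 2}. \<exists>b\<in>{1, 2}. (A \<longrightarrow> alternating a b 1 = 1) \<and> (B \<longrightarrow> alternating a b (l - 2) = 1)"
proof -
  obtain m where m: "l = Suc (Suc m)" using l by (metis add_2_eq_Suc le_Suc_ex)
  have "m mod 4 < 4" by simp
  then consider "m mod 4 = 0" | "m mod 4 = 1" | "m mod 4 = 2" | "m mod 4 = 3" by linarith
  then show ?thesis
  proof cases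
    case 3
    then show ?thesis by (intro bexI[of _ 2] bexI[of _ 1]) (auto simp: m alternating_def)
  next
    case 4
    then have "\<not> (A \<and> B)" using one by (simp add: m mod_Suc)
    then show ?thesis using 4
      by (intro bexI[of _ 1] bexI[of _ "if A then 1 else 2"]) (auto simp: m alternating_def)
  qed (intro bexI[of _ 1]; auto simp: m alternating_def)+
qed

text \<open>For \<open>l mod 4 = 3\<close> the two end edges would be at distance 2 modulo 4 and have different weights.\<close>

lemma weights_for_end_edges:
  fixes l :: nat
  assumes l: "l \<ge> 1" "l mod 4 \<noteq> 3"
  shows "\<exists>b\<in>{1, 2}. alternating 2 b (l - 1) = 2"
proof -
  obtain m where m: "l = Suc m" using l by (cases l) auto
  have "m mod 4 < 4" by simp
  then consider "m mod 4 = 0" | "m mod 4 = 1" | "m mod 4 = 3"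
    using l(2) m by (fastforce simp: mod_Suc)
  then show ?thesis
  proof cases
    case 2
    then show ?thesis by (intro bexI[of _ 2]) (auto simp: m alternating_def)
  qed (intro bexI[of _ 1]; auto simp: m alternating_def)+
qed

section \<open>The three constructions\<close>

text \<open>The weights 1, 1, 2, 2 are repeated around the cycle. Since 4 divides \<open>n\<close>, the pattern has no
  break where it closes up.\<close>

lemma cycle_vertex_coloring_edge_weighting:
  fixes V :: "'a set"
  assumes cyc: "is_cycle_of_length V E n" and n: "n mod 4 = 0"
  shows "\<exists>w. vertex_coloring_edge_weighting E 2 w"
proof -
  obtain f where n3: "n \<ge> 3" and bij: "bij_betw f {..<n} V"
    and E: "E = {{f i, f (Suc i mod n)} | i. i < n}"
    using cyc unfolding is_cycle_of_length_def by blast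
  define s where "s i = Suc i mod n" for i
  define ed where "ed i = {f i, f (s i)}" for i
  have s_lt: "s i < n" for i using n3 by (simp add: s_def)
  have E': "E = ed ` {..<n}" unfolding E ed_def s_def by auto
  have f_eq: "f i = f j \<longleftrightarrow> i = j" if "i < n" "j < n" for i j
    using bij that by (auto simp: bij_betw_def inj_on_eq_iff)
  have s_inj: "s i = s j \<longleftrightarrow> i = j" if "i < n" "j < n" for i j
    using that by (auto simp: s_def mod_Suc split: if_splits)
  (* The edges ed i and ed j with j = s i and i = s j would coincide; n >= 3 rules this out. *)
  have ss: "s (s i) \<noteq> i" "s i \<noteq> i" if "i < n" for i
    using that n3 by (auto simp: s_def mod_Suc split: if_splits)
  have ed_inj: "inj_on ed {..<n}"
    by (rule inj_onI) (use ss f_eq s_lt in \<open>auto simp: ed_def doubleton_eq_iff\<close>)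
  let ?\<phi> = "alternating 1 1"
  define w where "w e = ?\<phi> (the_inv_into {..<n} ed e)" for e
  have w: "w (ed i) = ?\<phi> i" if "i < n" for i
    unfolding w_def using the_inv_into_f_f[OF ed_inj] that by simp
  have col: "induced_coloring E w (f (s i)) = ?\<phi> i + ?\<phi> (s i)" if i: "i < n" for i
  proof -
    have "{e \<in> E. f (s i) \<in> e} = {ed i, ed (s i)}"
      unfolding E' using i s_lt f_eq s_inj by (auto simp: ed_def)
    moreover have "ed i \<noteq> ed (s i)" using ed_inj i s_lt ss[OF i] by (metis inj_onD lessThan_iff)
    ultimately show ?thesis unfolding induced_coloring_def using w i s_lt by simp
  qed
  have phi_s: "?\<phi> (s (s i)) \<noteq> ?\<phi> i" for i
  proof -
    have "s (s i) mod 4 = Suc (Suc i) mod 4"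
      using n by (simp add: s_def mod_mod_cancel mod_0_imp_dvd mod_Suc_eq mod_Suc_Suc_eq)
    then have "?\<phi> (s (s i)) = ?\<phi> (Suc (Suc i))" by (simp add: alternating_def)
    then show ?thesis using alternating_neq[of 1 1 i] by simp
  qed
  have "proper_coloring E (induced_coloring E w)"
    unfolding proper_coloring_def
  proof (intro allI impI)
    fix u v assume "{u, v} \<in> E"
    then obtain j where j: "j < n" "{u, v} = ed j" unfolding E' by auto
    have "j \<in> s ` {..<n}"
    proof -
      have "j = s (if j = 0 then n - 1 else j - 1)" using j n3 by (auto simp: s_def)
      then show ?thesis using j n3
        by (metis imageI lessThan_iff diff_less less_imp_diff_less zero_less_one gr_zeroI less_zeroE)
    qed
    then obtain i where i: "i < n" "j = s i" by auto
    have "induced_coloring E w (f j) \<noteq> induced_coloring E w (f (s j))"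
      using col[OF i(1)] col[OF j(1)] phi_s[of i] i(2) by simp
    then show "induced_coloring E w u \<noteq> induced_coloring E w v"
      using j(2) by (auto simp: ed_def doubleton_eq_iff)
  qed
  moreover have "edge_weighting E 2 w"
    unfolding edge_weighting_def
  proof
    fix e assume "e \<in> E"
    then obtain i where "i < n" "e = ed i" unfolding E' by auto
    then show "w e \<in> {1..2}" using w alternating_range[of 1 1 i] by auto
  qed
  ultimately show ?thesis unfolding vertex_coloring_edge_weighting_def by blast
qed

text \<open>Every path has a second edge from either end, and \<open>P\<close> gives it weight 1 wherever that end has
  degree 3.\<close>

lemma no_single_edge_path_vertex_coloring_edge_weighting:
  fixes V :: "'a set"
  assumes G: "fin_simple_graph V E"
    and ends: "\<And>xs. maximal_simple_path V E xs \<Longrightarrow> degree E (hd xs) \<noteq> 2 \<and> degree E (last xs) \<noteq> 2"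
    and long: "\<And>xs. maximal_simple_path V E xs \<Longrightarrow> walk_length xs \<noteq> 1"
    and one: "\<And>xs. maximal_simple_path V E xs \<Longrightarrow> walk_length xs mod 4 = 1 \<Longrightarrow>
             {degree E (hd xs), degree E (last xs)} \<noteq> {3}"
  shows "\<exists>w. vertex_coloring_edge_weighting E 2 w"
proof -
  let ?l = walk_length
  define P where "P xs \<phi> \<longleftrightarrow> (\<forall>i. \<phi> i \<in> {1, 2}) \<and> (\<forall>i. \<phi> i \<noteq> \<phi> (Suc (Suc i))) \<and>
      (degree E (hd xs) = 3 \<longrightarrow> \<phi> 1 = 1) \<and> (degree E (last xs) = 3 \<longrightarrow> \<phi> (?l xs - 2) = 1)"
    for xs :: "'a list" and \<phi> :: "nat \<Rightarrow> nat"
  have ex: "\<exists>\<phi>. P xs \<phi>" if xs: "maximal_simple_path V E xs" for xs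
  proof -
    have "?l xs \<ge> 1" using xs simple_path_length by (auto simp: maximal_simple_path_def)
    then have "?l xs \<ge> 2" using long[OF xs] by linarith
    then obtain a b where ab: "a \<in> {1, 2}" "b \<in> {1, 2}"
      "degree E (hd xs) = 3 \<longrightarrow> alternating a b 1 = 1"
      "degree E (last xs) = 3 \<longrightarrow> alternating a b (?l xs - 2) = 1"
      using weights_for_second_edges[of "?l xs" "degree E (hd xs) = 3" "degree E (last xs) = 3"]
        one[OF xs] by auto
    then have "P xs (alternating a b)"
      unfolding P_def using alternating_range[OF ab(1,2)] alternating_neq[OF ab(1,2)] by blast
    then show ?thesis by blast
  qed
  have "\<exists>w :: 'a set \<Rightarrow> nat. \<forall>e\<in>E. \<exists>xs. maximal_simple_path V E xs \<and> e \<in> set (walk_edges xs) \<and>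
           (\<exists>\<phi>. P xs \<phi> \<and> (\<forall>j<?l xs. w (walk_edges xs ! j) = \<phi> j))"
    using ends ex by (rule weighting_from_paths[OF G])
  then obtain w where
    w: "\<And>e. e \<in> E \<Longrightarrow> \<exists>xs. maximal_simple_path V E xs \<and> e \<in> set (walk_edges xs) \<and>
           (\<exists>\<phi>. P xs \<phi> \<and> (\<forall>j<?l xs. w (walk_edges xs ! j) = \<phi> j))" by blast
  have range: "w e \<in> {1, 2}" if "e \<in> E" for e
    using w[OF that] by (metis P_def in_set_conv_nth walk_length_def)
  have "proper_coloring E (induced_coloring E w)"
  proof (rule proper_coloring_from_paths[OF G])
    fix e assume "e \<in> E"
    from w[OF this] obtain xs \<phi> where max: "maximal_simple_path V E xs"
      and e: "e \<in> set (walk_edges xs)" and P: "P xs \<phi>"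
      and \<phi>: "\<And>j. j < ?l xs \<Longrightarrow> w (walk_edges xs ! j) = \<phi> j" by blast
    have xs: "simple_path V E xs" using max by (simp add: maximal_simple_path_def)
    have "?l xs \<ge> 2" using simple_path_length(2)[OF xs] long[OF max] by linarith
    then obtain m where m: "?l xs = Suc (Suc m)" by (metis add_2_eq_Suc le_Suc_ex)
    note deg = ends[OF max, unfolded simple_path_ends[OF xs]]
    note P' = P[unfolded P_def simple_path_ends[OF xs]]
    have first: "induced_coloring E w (xs ! 0) \<noteq> induced_coloring E w (xs ! 1)"
    proof -
      have "induced_coloring E w (xs ! 0) \<noteq> w (walk_edges xs ! 0) + \<phi> 1"
        by (rule induced_coloring_end_vertex[OF G])
           (use range simple_path_edge[OF xs, of 0] deg m P' in force)+
      then show ?thesis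
        using induced_coloring_internal_vertex[OF G xs, of 0 w] \<phi> m by simp
    qed
    have last: "induced_coloring E w (xs ! ?l xs) \<noteq> induced_coloring E w (xs ! (?l xs - 1))"
    proof -
      have "induced_coloring E w (xs ! ?l xs) \<noteq> w (walk_edges xs ! Suc m) + \<phi> m"
        by (rule induced_coloring_end_vertex[OF G])
           (use range simple_path_edge[OF xs, of "Suc m"] deg m P' in force)+
      then show ?thesis
        using induced_coloring_internal_vertex[OF G xs, of m w] \<phi> m by simp
    qed
    show "\<exists>xs. simple_path V E xs \<and> e \<in> set (walk_edges xs) \<and>
      (\<forall>i. Suc (Suc i) < ?l xs \<longrightarrow> w (walk_edges xs ! i) \<noteq> w (walk_edges xs ! Suc (Suc i))) \<and>
      induced_coloring E w (xs ! 0) \<noteq> induced_coloring E w (xs ! 1) \<and>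
      induced_coloring E w (xs ! (?l xs - 1)) \<noteq> induced_coloring E w (xs ! ?l xs)"
      using xs e first last[symmetric] \<phi> P' by (intro exI[of _ xs]) auto
  qed
  moreover have "edge_weighting E 2 w"
    unfolding edge_weighting_def using range by fastforce
  ultimately show ?thesis unfolding vertex_coloring_edge_weighting_def by blast
qed

text \<open>The end edges have weight 2, so the colour of an end-vertex is twice its degree. It is thus never
  3 or 4, the possible colours of a vertex of degree 2 on an edge of weight 2.\<close>

lemma no_three_mod_four_path_vertex_coloring_edge_weighting:
  fixes V :: "'a set"
  assumes G: "fin_simple_graph V E"
    and ends: "\<And>xs. maximal_simple_path V E xs \<Longrightarrow> degree E (hd xs) \<noteq> 2 \<and> degree E (last xs) \<noteq> 2"
    and three: "\<And>xs. maximal_simple_path V E xs \<Longrightarrow> walk_length xs mod 4 \<noteq> 3"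
    and single: "\<And>x y. {x, y} \<in> E \<Longrightarrow> maximal_simple_path V E [x, y] \<Longrightarrow> degree E x \<noteq> degree E y"
  shows "\<exists>w. vertex_coloring_edge_weighting E 2 w"
proof -
  let ?l = walk_length
  define P where "P xs \<phi> \<longleftrightarrow> (\<forall>i. \<phi> i \<in> {1, 2}) \<and> (\<forall>i. \<phi> i \<noteq> \<phi> (Suc (Suc i))) \<and>
      \<phi> 0 = 2 \<and> \<phi> (?l xs - 1) = 2"
    for xs :: "'a list" and \<phi> :: "nat \<Rightarrow> nat"
  have ex: "\<exists>\<phi>. P xs \<phi>" if xs: "maximal_simple_path V E xs" for xs
  proof -
    have "?l xs \<ge> 1" using xs simple_path_length by (auto simp: maximal_simple_path_def)
    then obtain b where b: "b \<in> {1, 2}" "alternating 2 b (?l xs - 1) = 2"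
      using weights_for_end_edges three[OF xs] by blast
    moreover have "alternating 2 b 0 = 2" by (simp add: alternating_def)
    ultimately have "P xs (alternating 2 b)"
      unfolding P_def using alternating_range[of 2 b] alternating_neq[of 2 b] by blast
    then show ?thesis by blast
  qed
  have "\<exists>w :: 'a set \<Rightarrow> nat. \<forall>e\<in>E. \<exists>xs. maximal_simple_path V E xs \<and> e \<in> set (walk_edges xs) \<and>
           (\<exists>\<phi>. P xs \<phi> \<and> (\<forall>j<?l xs. w (walk_edges xs ! j) = \<phi> j))"
    using ends ex by (rule weighting_from_paths[OF G])
  then obtain w where
    w: "\<And>e. e \<in> E \<Longrightarrow> \<exists>xs. maximal_simple_path V E xs \<and> e \<in> set (walk_edges xs) \<and>
           (\<exists>\<phi>. P xs \<phi> \<and> (\<forall>j<?l xs. w (walk_edges xs ! j) = \<phi> j))" by blast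
  have range: "w e \<in> {1, 2}" if "e \<in> E" for e
    using w[OF that] by (metis P_def in_set_conv_nth walk_length_def)
  have col: "induced_coloring E w x = 2 * degree E x" if deg: "degree E x \<noteq> 2" for x
  proof -
    have "w e = 2" if e: "e \<in> E" "x \<in> e" for e
    proof -
      from w[OF e(1)] obtain xs \<phi> where max: "maximal_simple_path V E xs"
        and ein: "e \<in> set (walk_edges xs)" and P: "P xs \<phi>"
        and \<phi>: "\<And>j. j < ?l xs \<Longrightarrow> w (walk_edges xs ! j) = \<phi> j" by blast
      have xs: "simple_path V E xs" using max by (simp add: maximal_simple_path_def)
      obtain i where i: "i < ?l xs" "e = walk_edges xs ! i"
        using ein by (metis in_set_conv_nth walk_length_def)
      have "x = xs ! i \<or> x = xs ! Suc i" using e(2) i simple_path_edge[OF xs] by auto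
      then have "i = 0 \<or> Suc i = ?l xs"
        using simple_path_degree[OF xs, of i] simple_path_degree[OF xs, of "Suc i"] deg i(1)
        by fastforce
      then show ?thesis using P \<phi>[OF i(1)] i by (auto simp: P_def dest: arg_cong[of _ _ "\<lambda>k. k - 1"])
    qed
    then show ?thesis by (simp add: induced_coloring_def degree_def)
  qed
  have "proper_coloring E (induced_coloring E w)"
  proof (rule proper_coloring_from_paths[OF G])
    fix e assume "e \<in> E"
    from w[OF this] obtain xs \<phi> where max: "maximal_simple_path V E xs"
      and e: "e \<in> set (walk_edges xs)" and P: "P xs \<phi>"
      and \<phi>: "\<And>j. j < ?l xs \<Longrightarrow> w (walk_edges xs ! j) = \<phi> j" by blast
    have xs: "simple_path V E xs" using max by (simp add: maximal_simple_path_def)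
    note deg = ends[OF max, unfolded simple_path_ends[OF xs]]
    note L = simple_path_length[OF xs]
    have "induced_coloring E w (xs ! 0) \<noteq> induced_coloring E w (xs ! 1) \<and>
      induced_coloring E w (xs ! (?l xs - 1)) \<noteq> induced_coloring E w (xs ! ?l xs)"
    proof (cases "?l xs = 1")
      case True
      then obtain x y where xy: "xs = [x, y]" using L(1) by (auto simp: length_Suc_conv)
      then have "degree E x \<noteq> degree E y"
        using single max simple_path_edge(2)[OF xs, of 0] True by simp
      then show ?thesis using True deg xy by (simp add: col)
    next
      case False
      then have "?l xs \<ge> 2" using L(2) by linarith
      then obtain m where m: "?l xs = Suc (Suc m)" by (metis add_2_eq_Suc le_Suc_ex)
      have "\<phi> 0 = 2" "\<phi> (Suc m) = 2" "\<phi> 1 \<in> {1, 2}" "\<phi> m \<in> {1, 2}"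
        using P m by (auto simp: P_def)
      then have "induced_coloring E w (xs ! 1) \<in> {3, 4}" "induced_coloring E w (xs ! Suc m) \<in> {3, 4}"
        using induced_coloring_internal_vertex[OF G xs, of 0 w]
          induced_coloring_internal_vertex[OF G xs, of m w] \<phi> m by auto
      moreover have "2 * degree E x \<noteq> 3" "degree E x \<noteq> 2 \<Longrightarrow> 2 * degree E x \<noteq> 4" for x
        by presburger+
      ultimately show ?thesis using deg m by (auto simp: col)
    qed
    then show "\<exists>xs. simple_path V E xs \<and> e \<in> set (walk_edges xs) \<and>
      (\<forall>i. Suc (Suc i) < ?l xs \<longrightarrow> w (walk_edges xs ! i) \<noteq> w (walk_edges xs ! Suc (Suc i))) \<and>
      induced_coloring E w (xs ! 0) \<noteq> induced_coloring E w (xs ! 1) \<and>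
      induced_coloring E w (xs ! (?l xs - 1)) \<noteq> induced_coloring E w (xs ! ?l xs)"
      using xs e \<phi> P by (intro exI[of _ xs]) (auto simp: P_def)
  qed
  moreover have "edge_weighting E 2 w"
    unfolding edge_weighting_def using range by fastforce
  ultimately show ?thesis unfolding vertex_coloring_edge_weighting_def by blast
qed

theorem theorem3p3:
  fixes V :: "'a set" and E :: "'a set set"
  assumes "fin_simple_graph V E"
    and "connected_graph V E"
    and "card V \<ge> 3"
    and "\<not> (\<exists>k r. r \<in> {1, 2, 3} \<and> is_cycle_of_length V E (4 * k + r))"
    and "((\<forall>xs. maximal_simple_path V E xs \<longrightarrow> walk_length xs \<noteq> 1) \<and>
          (\<forall>xs. maximal_simple_path V E xs \<and> walk_length xs mod 4 = 1 \<longrightarrow>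
             {degree E (hd xs), degree E (last xs)} \<noteq> {3})) \<or>
         ((\<forall>xs. maximal_simple_path V E xs \<longrightarrow> walk_length xs mod 4 \<noteq> 3) \<and>
          (\<forall>x y. {x, y} \<in> E \<and> maximal_simple_path V E [x, y] \<longrightarrow>
             degree E x \<noteq> degree E y))"
  shows "mu E \<le> 2"
proof -
  have "\<exists>w. vertex_coloring_edge_weighting E 2 w"
  proof (cases "\<exists>n. is_cycle_of_length V E n")
    case True
    then obtain n where n: "is_cycle_of_length V E n" by blast
    have "n mod 4 \<notin> {1, 2, 3}"
      using assms(4) n by (metis mult_div_mod_eq)
    moreover have "n mod 4 < 4" by simp
    ultimately have "n mod 4 = 0" by auto
    then show ?thesis by (rule cycle_vertex_coloring_edge_weighting[OF n])
  next
    case False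
    note ends = maximal_simple_path_ends[OF assms(1,2) False]
    from assms(5) show ?thesis
    proof (elim disjE conjE)
      assume *: "\<forall>xs. maximal_simple_path V E xs \<longrightarrow> walk_length xs \<noteq> 1"
        "\<forall>xs. maximal_simple_path V E xs \<and> walk_length xs mod 4 = 1 \<longrightarrow>
             {degree E (hd xs), degree E (last xs)} \<noteq> {3}"
      show ?thesis
        by (rule no_single_edge_path_vertex_coloring_edge_weighting[OF assms(1) ends])
           (use * in auto)
    next
      assume *: "\<forall>xs. maximal_simple_path V E xs \<longrightarrow> walk_length xs mod 4 \<noteq> 3"
        "\<forall>x y. {x, y} \<in> E \<and> maximal_simple_path V E [x, y] \<longrightarrow> degree E x \<noteq> degree E y"
      show ?thesis
        by (rule no_three_mod_four_path_vertex_coloring_edge_weighting[OF assms(1) ends])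
           (use * in auto)
    qed
  qed
  then have "mu E \<le> enat 2" unfolding mu_def by (intro Inf_lower) blast
  then show ?thesis by (simp add: numeral_eq_enat)
qed

end
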